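(* Let $f\in O_n$, let $\mathbf t$ be a direction such that $\operatorname{supp}(f_{\mathbf t})$ is not a subset of a line, and let $\mu$ be a random phase mask satisfying the Mask Assumption. Then almost surely (with respect to $\mu$) the following holds. If $g\in O_n$ satisfies $$|\mathcal F(g^*_{\mathbf t})|^2=|\mathcal F(f^*_{\mathbf t})|^2\quad\text{and}\quad|\mathcal F(\mu\odot g^*_{\mathbf t})|^2=|\mathcal F(\mu\odot f^*_{\mathbf t})|^2$$ on $[-\tfrac12,\tfrac12]^2$, then $g_{\mathbf t}=e^{\mathrm i\theta_{\mathbf t}}f_{\mathbf t}$ for some constant $\theta_{\mathbf t}\in\mathbb R$.
   Context: Let $n$ be a positive odd integer, $p=2n-1$, and for odd $m$ let $\mathbb Z_m=\{-(m-1)/2,\dots,(m-1)/2\}$. $O_n$ is the set of all functions $f:\mathbb Z_n^3\to\mathbb C$. Let $D_p(t)=\frac1p\sum_{l\in\mathbb Z_p}e^{\mathrm i2\pi lt/p}$ and, for $f\in O_n$, $\widetilde f(x,y,z)=\sum_{i,j,k\in\mathbb Z_n}f(i,j,k)D_p(x-i)D_p(y-j)D_p(z-k)$ for $x,y,z\in\mathbb R$. Directions $\mathbf t$ are vectors of one of the forms $(1,\alpha,\beta)$, $(\alpha,1,\beta)$, $(\alpha,\beta,1)$ with $|\alpha|,|\beta|<1$. The discrete projection $f_{\mathbf t}:\mathbb Z_p^2\to\mathbb C$ is, for $(c_1,c_2)\in\mathbb Z_p^2$, $f_{(1,\alpha,\beta)}(c_1,c_2)=\sum_{i\in\mathbb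 Z_n}\widetilde f(i,\alpha i+c_1,\beta i+c_2)$, $f_{(\alpha,1,\beta)}(c_1,c_2)=\sum_{j\in\mathbb Z_n}\widetilde f(\alpha j+c_1,j,\beta j+c_2)$, $f_{(\alpha,\beta,1)}(c_1,c_2)=\sum_{k\in\mathbb Z_n}\widetilde f(\alpha k+c_1,\beta k+c_2,k)$. Translated projections: for the direction $\mathbf t$ there is a shift $\mathbf l_{\mathbf t}\in\mathbb Z^2$ (the same for $f$ and $g$), and $f^*_{\mathbf t}(\mathbf n)=f_{\mathbf t}(\mathbf n+\mathbf l_{\mathbf t})$, $g^*_{\mathbf t}(\mathbf n)=g_{\mathbf t}(\mathbf n+\mathbf l_{\mathbf t})$ (projections being extended by zero outside $\mathbb Z_p^2$). It is a standing assumption that $\operatorname{supp}(f^*_{\mathbf t})\subseteq\mathbb Z_n^2$ and $\operatorname{supp}(g^*_{\mathbf t})\subseteq\mathbb Z_n^2$. For $u:\mathbb Z_p^2\to\mathbb C$, $\mathcal F(u)(\mathbf w)=\sum_{\mathbf n\in\mathbb Z_p^2}u(\mathbf n)e^{-\mathrm i2\pi\mathbf n\cdot\mathbf w}$, $\mathbf w\in[-\frac12,\frac12]^2$; $\odot$ is the entrywise product. Mask Assumption: $\mu(\mathbf n)=\exp[\mathrm i\phi(\mathbf n)]$, $\mathbf n\in\mathbb Z_p^2$, where the $\phi(\mathbf n)$ are independent, continuous real-valued random variables (i.e. with continuous distribution functions). *)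

theory Defs
  imports "HOL-Probability.Probability"
begin

definition Zc :: "nat \<Rightarrow> int set" where
  "Zc m = {- ((int m - 1) div 2) .. (int m - 1) div 2}"

definition objects :: "nat \<Rightarrow> (int \<times> int \<times> int \<Rightarrow> complex) set" where
  "objects n = (Zc n \<times> Zc n \<times> Zc n) \<rightarrow>\<^sub>E UNIV"

definition dirichlet :: "nat \<Rightarrow> real \<Rightarrow> complex" where
  "dirichlet p t =
     (1 / of_nat p) * (\<Sum>l\<in>Zc p. exp (\<i> * complex_of_real (2 * pi * real_of_int l * t / real p)))"

definition interp :: "nat \<Rightarrow> (int \<times> int \<times> int \<Rightarrow> complex) \<Rightarrow> real \<Rightarrow> real \<Rightarrow> real \<Rightarrow> complex" where
  "interp n f x y z =
     (let p = 2 * n - 1 in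
      \<Sum>(i, j, k)\<in>Zc n \<times> Zc n \<times> Zc n.
        f (i, j, k) * dirichlet p (x - real_of_int i)
          * dirichlet p (y - real_of_int j) * dirichlet p (z - real_of_int k))"

definition direction :: "real \<times> real \<times> real \<Rightarrow> bool" where
  "direction t \<longleftrightarrow>
     (\<exists>\<alpha> \<beta>. \<bar>\<alpha>\<bar> < 1 \<and> \<bar>\<beta>\<bar> < 1 \<and> (t = (1, \<alpha>, \<beta>) \<or> t = (\<alpha>, 1, \<beta>) \<or> t = (\<alpha>, \<beta>, 1)))"

(* For a direction exactly one coordinate equals 1, so the case distinction below selects
   the intended form.  The projection lives on Zc p x Zc p and is extended by zero to
   all of Z x Z. *)
definition projection ::
  "nat \<Rightarrow> (int \<times> int \<times> int \<Rightarrow> complex) \<Rightarrow> real \<times> real \<times> real \<Rightarrow> int \<times> int \<Rightarrow> complex" where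
  "projection n f t c =
     (case t of (t1, t2, t3) \<Rightarrow> case c of (c1, c2) \<Rightarrow>
      let p = 2 * n - 1 in
      if (c1, c2) \<notin> Zc p \<times> Zc p then 0
      else if t1 = 1 then
        (\<Sum>i\<in>Zc n. interp n f (of_int i) (t2 * of_int i + of_int c1) (t3 * of_int i + of_int c2))
      else if t2 = 1 then
        (\<Sum>j\<in>Zc n. interp n f (t1 * of_int j + of_int c1) (of_int j) (t3 * of_int j + of_int c2))
      else
        (\<Sum>k\<in>Zc n. interp n f (t1 * of_int k + of_int c1) (t2 * of_int k + of_int c2) (of_int k)))"

definition translate :: "int \<times> int \<Rightarrow> (int \<times> int \<Rightarrow> complex) \<Rightarrow> int \<times> int \<Rightarrow> complex" where
  "translate l u k = u (fst k + fst l, snd k + snd l)"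

definition supp :: "(int \<times> int \<Rightarrow> complex) \<Rightarrow> (int \<times> int) set" where
  "supp u = {k. u k \<noteq> 0}"

(* HOL-Analysis' collinear says that a set is contained in a line; it is applied to the
   integer points viewed in the real plane. *)
definition subset_of_line :: "(int \<times> int) set \<Rightarrow> bool" where
  "subset_of_line S \<longleftrightarrow> collinear ((\<lambda>(a, b). (real_of_int a, real_of_int b)) ` S)"

definition fourier :: "nat \<Rightarrow> (int \<times> int \<Rightarrow> complex) \<Rightarrow> real \<times> real \<Rightarrow> complex" where
  "fourier p u w =
     (\<Sum>(k1, k2)\<in>Zc p \<times> Zc p.
        u (k1, k2) *
          exp (- \<i> * complex_of_real (2 * pi * (real_of_int k1 * fst w + real_of_int k2 * snd w))))"

definition freq_domain :: "(real \<times> real) set" where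
  "freq_domain = {-1/2..1/2} \<times> {-1/2..1/2}"

definition mask_assumption :: "'a measure \<Rightarrow> nat \<Rightarrow> (int \<times> int \<Rightarrow> 'a \<Rightarrow> complex) \<Rightarrow> bool" where
  "mask_assumption M p \<mu> \<longleftrightarrow>
     (\<exists>\<phi> :: int \<times> int \<Rightarrow> 'a \<Rightarrow> real.
        prob_space.indep_vars M (\<lambda>_. borel) \<phi> (Zc p \<times> Zc p) \<and>
        (\<forall>k\<in>Zc p \<times> Zc p. continuous_on UNIV (cdf (distr M borel (\<phi> k)))) \<and>
        (\<forall>k\<in>Zc p \<times> Zc p. \<forall>\<omega>\<in>space M. \<mu> k \<omega> = exp (\<i> * complex_of_real (\<phi> k \<omega>))))"

end

theory Submission
  imports Defs "HOL-Computational_Algebra.Fundamental_Theorem_Algebra"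
begin

text \<open>
  Write \<open>u\<close> and \<open>v\<close> for the translated projections of \<open>f\<close> and \<open>g\<close>. The unmasked data alone leave
  only finitely many candidates \<open>v\<close> up to a global phase: Kronecker substitution turns
  \<open>|Fv| = |Fu|\<close> into \<open>|Q| = |P|\<close> on the unit circle for univariate polynomials, and then the roots
  of \<open>Q\<close> form a sub-multiset of a fixed finite one. For each fixed candidate, the masked data at the
  single frequency \<open>0\<close> give a trigonometric polynomial in the independent phases \<open>\<phi>(k)\<close> which almost
  surely does not vanish unless its coefficients \<open>v(j) cnj(v(k)) - u(j) cnj(u(k))\<close>, \<open>j \<noteq> k\<close>, are all
  zero. The support of \<open>u\<close>, not being contained in a line, has at least three points, and then the
  vanishing of these coefficients forces \<open>v = e\<^sup>i\<^sup>\<theta> u\<close>.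
\<close>

section \<open>Countable sets of angles\<close>

lemma countable_cis_vimage:
  assumes "finite F"
  shows "countable {x. cis x \<in> F}"
proof -
  have "countable {x. cis x = w}" for w
  proof (cases "\<exists>x0. cis x0 = w")
    case True
    then obtain x0 where "cis x0 = w" by blast
    then have "{x. cis x = w} \<subseteq> range (\<lambda>k::int. x0 + 2 * pi * of_int k)"
      using sin_cos_eq_iff[of _ x0] by (auto simp: complex_eq_iff)
    then show ?thesis by (rule countable_subset) simp
  qed simp
  moreover have "{x. cis x \<in> F} = (\<Union>w\<in>F. {x. cis x = w})" by auto
  ultimately show ?thesis using assms by (simp add: countable_finite)
qed

text \<open>For \<open>w = cis x\<close> the conjugate is the inverse, so multiplying the doubled
  equation by \<open>w\<close> gives the quadratic \<open>q * w^2 - 2 * r * w + cnj q = 0\<close>.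
  It is nontrivial because \<open>q \<noteq> 0\<close>, which leaves at most two values of
  \<open>w\<close>.\<close>

lemma countable_Re_cis_eq:
  assumes "q \<noteq> 0"
  shows "countable {x. Re (cis x * q) = r}"
proof (rule countable_subset)
  let ?P = "[:cnj q, - 2 * of_real r, q:]"
  show "{x. Re (cis x * q) = r} \<subseteq> {x. cis x \<in> {w. poly ?P w = 0}}"
  proof (intro subsetI CollectI)
    fix x assume "x \<in> {x. Re (cis x * q) = r}"
    then have r: "r = Re (cis x * q)" by simp
    let ?w = "cis x"
    have "2 * of_real (Re (?w * q)) = ?w * q + cnj (?w * q)"
      by (subst complex_add_cnj) simp
    then have "poly ?P ?w = cnj q - ?w * (?w * q + cnj ?w * cnj q) + ?w * ?w * q"
      unfolding r by (simp add: algebra_simps)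
    also have "\<dots> = cnj q * (1 - ?w * cnj ?w)"
      by (simp add: algebra_simps)
    also have "?w * cnj ?w = 1"
      by (simp add: cis_cnj cis_mult)
    finally show "poly ?P ?w = 0" by simp
  qed
  show "countable {x. cis x \<in> {w. poly ?P w = 0}}"
    using assms by (intro countable_cis_vimage poly_roots_finite) simp
qed

section \<open>Null events for independent phases\<close>

text \<open>By independence the joint law is the product of the two laws, and Fubini reduces the
  claim to the sections with \<open>y\<close> fixed.\<close>

lemma (in prob_space) AE_indep_var:
  assumes ind: "indep_var N Y N' X"
    and meas: "Measurable.pred (N \<Otimes>\<^sub>M N') (\<lambda>z. P (fst z) (snd z))"
    and AE: "\<And>y. y \<in> space N \<Longrightarrow> AE \<omega> in M. P y (X \<omega>)"
  shows "AE \<omega> in M. P (Y \<omega>) (X \<omega>)"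
proof -
  have X [measurable]: "random_variable N' X" and Y [measurable]: "random_variable N Y"
    and D: "distr M N Y \<Otimes>\<^sub>M distr M N' X = distr M (N \<Otimes>\<^sub>M N') (\<lambda>\<omega>. (Y \<omega>, X \<omega>))"
    using ind by (auto simp: indep_var_distribution_eq)
  interpret DX: prob_space "distr M N' X" using X by (rule prob_space_distr)
  interpret DY: prob_space "distr M N Y" using Y by (rule prob_space_distr)
  interpret P: pair_prob_space "distr M N Y" "distr M N' X" ..
  have "AE x in distr M N' X. P y x" if "y \<in> space N" for y
  proof (subst AE_distr_iff)
    have "Measurable.pred N' (\<lambda>x. P (fst (y, x)) (snd (y, x)))"
      by (rule measurable_compose[OF measurable_Pair1'[OF that] meas])
    then show "{x \<in> space N'. P y x} \<in> sets N'" by (simp add: pred_def)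
  qed (use that AE X in auto)
  then have "AE y in distr M N Y. AE x in distr M N' X. P (fst (y, x)) (snd (y, x))"
    unfolding fst_conv snd_conv by (rule AE_I2) (simp only: space_distr)
  then have "AE z in distr M N Y \<Otimes>\<^sub>M distr M N' X. P (fst z) (snd z)"
    using meas unfolding pred_def
    by (intro P.AE_pair_measure) (auto simp: space_pair_measure cong: sets_pair_measure_cong)
  then show ?thesis
    unfolding D using meas by (subst (asm) AE_distr_iff) (auto simp: pred_def)
qed

text \<open>A continuous distribution function has no atoms, so \<open>\<phi> k\<close> almost
  surely avoids any fixed countable set. Independence lets this set depend on the variables in
  \<open>J\<close>.\<close>

lemma (in prob_space) AE_indep_vars_not_countable:
  fixes \<phi> :: "'i \<Rightarrow> 'a \<Rightarrow> real"
  assumes ind: "indep_vars (\<lambda>_. borel) \<phi> I" and k: "k \<in> I" and J: "J \<subseteq> I - {k}"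
    and cont: "continuous_on UNIV (cdf (distr M borel (\<phi> k)))"
    and meas: "Measurable.pred (PiM J (\<lambda>_. borel) \<Otimes>\<^sub>M borel) (\<lambda>z. P (fst z) (snd z))"
    and count: "\<And>y. countable {x. P y x}"
  shows "AE \<omega> in M. \<not> P (restrict (\<lambda>i. \<phi> i \<omega>) J) (\<phi> k \<omega>)"
proof -
  have X [measurable]: "random_variable borel (\<phi> k)"
    using ind k by (auto simp: indep_vars_def)
  interpret DX: real_distribution "distr M borel (\<phi> k)" by simp
  have null: "AE \<omega> in M. \<phi> k \<omega> \<noteq> c" for c
  proof -
    have "measure (distr M borel (\<phi> k)) {c} = 0"
      using cont DX.isCont_cdf[of c] by (simp add: continuous_on_eq_continuous_at)
    then have "AE x in distr M borel (\<phi> k). x \<noteq> c"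
      by (intro AE_I[of _ _ "{c}"]) (auto simp: DX.emeasure_eq_measure)
    then show ?thesis by (subst (asm) AE_distr_iff) auto
  qed
  \<comment> \<open>\<open>indep_var_restrict\<close> concerns blocks of variables, so
    \<open>\<phi> k\<close> enters as the singleton block over \<open>{k}\<close>, evaluated at
    \<open>k\<close>.\<close>
  have "AE \<omega> in M. \<not> P (restrict (\<lambda>i. \<phi> i \<omega>) J) (restrict (\<lambda>i. \<phi> i \<omega>) {k} k)"
  proof (rule AE_indep_var[where P = "\<lambda>y x. \<not> P y (x k)"
        and Y = "\<lambda>\<omega>. restrict (\<lambda>i. \<phi> i \<omega>) J" and X = "\<lambda>\<omega>. restrict (\<lambda>i. \<phi> i \<omega>) {k}"])
    show "indep_var (PiM J (\<lambda>_. borel)) (\<lambda>\<omega>. restrict (\<lambda>i. \<phi> i \<omega>) J)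
        (PiM {k} (\<lambda>_. borel)) (\<lambda>\<omega>. restrict (\<lambda>i. \<phi> i \<omega>) {k})"
      using k J by (intro indep_var_restrict[OF ind]) auto
    have "(\<lambda>z. (fst z, snd z k)) \<in> PiM J (\<lambda>_. borel) \<Otimes>\<^sub>M PiM {k} (\<lambda>_. borel)
        \<rightarrow>\<^sub>M PiM J (\<lambda>_. borel) \<Otimes>\<^sub>M borel"
      by measurable
    from measurable_compose[OF this meas]
    show "Measurable.pred (PiM J (\<lambda>_. borel) \<Otimes>\<^sub>M PiM {k} (\<lambda>_. borel)) (\<lambda>z. \<not> P (fst z) (snd z k))"
      by simp
    fix y
    show "AE \<omega> in M. \<not> P y (restrict (\<lambda>i. \<phi> i \<omega>) {k} k)"
    proof -
      have "AE \<omega> in M. \<forall>c\<in>{x. P y x}. \<phi> k \<omega> \<noteq> c"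
        using null by (simp only: AE_ball_countable[OF count]) blast
      then show ?thesis by eventually_elim auto
    qed
  qed
  then show ?thesis by simp
qed

text \<open>Once the other phases are fixed, the sum can vanish only if
  \<open>cis (\<phi> k \<omega>)\<close> takes one particular value, since its coefficient
  \<open>d k\<close> is nonzero.\<close>

lemma (in prob_space) AE_random_phase_sum_nonzero:
  fixes \<phi> :: "'i \<Rightarrow> 'a \<Rightarrow> real"
  assumes ind: "indep_vars (\<lambda>_. borel) \<phi> I" and J: "finite J" "J \<subseteq> I" and k: "k \<in> J"
    and cont: "continuous_on UNIV (cdf (distr M borel (\<phi> k)))"
    and d: "d k \<noteq> 0"
  shows "AE \<omega> in M. (\<Sum>i\<in>J. cis (\<phi> i \<omega>) * d i) \<noteq> 0"
proof -
  let ?P = "\<lambda>y x. cis x * d k + (\<Sum>i\<in>J - {k}. cis (y i) * d i) = 0"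
  have [measurable]: "cis \<in> borel_measurable borel"
    by (intro borel_measurable_continuous_onI continuous_intros)
  have "AE \<omega> in M. \<not> ?P (restrict (\<lambda>i. \<phi> i \<omega>) (J - {k})) (\<phi> k \<omega>)"
  proof (rule AE_indep_vars_not_countable[OF ind _ _ cont])
    show "countable {x. ?P y x}" for y
    proof (rule countable_subset[OF _ countable_cis_vimage])
      let ?T = "\<Sum>i\<in>J - {k}. cis (y i) * d i"
      show "{x. ?P y x} \<subseteq> {x. cis x \<in> {- ?T / d k}}"
        using d by (auto simp: field_simps add_eq_0_iff)
    qed simp
  next
    show "Measurable.pred (PiM (J - {k}) (\<lambda>_. borel) \<Otimes>\<^sub>M borel) (\<lambda>z. ?P (fst z) (snd z))"
      by measurable
  qed (use J k in auto)
  then show ?thesis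
    using J k by (subst sum.remove[of J k]) auto
qed

lemma cmod_add_square: "(cmod (a + b))\<^sup>2 = (cmod a)\<^sup>2 + (cmod b)\<^sup>2 + 2 * Re (a * cnj b)"
  unfolding cmod_power2 by (simp add: power2_eq_square algebra_simps)

lemma measurable_pred_Re_cis_eq:
  fixes q :: "'b \<Rightarrow> complex" and r :: "'b \<Rightarrow> real"
  assumes [measurable]: "q \<in> borel_measurable N" "r \<in> borel_measurable N"
  shows "Measurable.pred (N \<Otimes>\<^sub>M borel) (\<lambda>z. q (fst z) \<noteq> 0 \<and> 2 * Re (cis (snd z) * q (fst z)) = r (fst z))"
proof -
  have [measurable]: "cis \<in> borel_measurable borel" "Re \<in> borel_measurable borel"
    by (intro borel_measurable_continuous_onI continuous_intros)+
  have [measurable]: "(\<lambda>z. 2 * Re (cis (snd z) * q (fst z))) \<in> borel_measurable (N \<Otimes>\<^sub>M borel)"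
    by measurable
  show ?thesis by measurable
qed

text \<open>Isolating the phase of \<open>j\<close>, the difference of the squared moduli is a
  constant plus \<open>2 * Re (cis (\<phi> j \<omega>) * q)\<close>, where \<open>q\<close> and the
  constant depend on the other phases only. By \<open>neq\<close>, \<open>q\<close> is up to
  conjugation a phase sum with nonzero coefficient at \<open>k\<close>, hence almost surely nonzero.
  Equality then confines \<open>\<phi> j\<close> to a countable set.\<close>

lemma (in prob_space) AE_cmod_random_phase_sum_neq:
  fixes \<phi> :: "'i \<Rightarrow> 'a \<Rightarrow> real"
  assumes ind: "indep_vars (\<lambda>_. borel) \<phi> I" and I: "finite I" and jk: "j \<in> I" "k \<in> I" "j \<noteq> k"
    and cont: "\<And>i. i \<in> I \<Longrightarrow> continuous_on UNIV (cdf (distr M borel (\<phi> i)))"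
    and neq: "v j * cnj (v k) \<noteq> u j * cnj (u k)"
  shows "AE \<omega> in M. cmod (\<Sum>i\<in>I. cis (\<phi> i \<omega>) * v i) \<noteq> cmod (\<Sum>i\<in>I. cis (\<phi> i \<omega>) * u i)"
proof -
  let ?S = "\<lambda>u y. \<Sum>i\<in>I - {j}. cis (y i) * u i"
  let ?q = "\<lambda>y. v j * cnj (?S v y) - u j * cnj (?S u y)"
  \<comment> \<open>The conjunct \<open>?q y \<noteq> 0\<close> makes the set of bad angles
    countable for every \<open>y\<close>: it is empty when \<open>?q y\<close> vanishes.\<close>
  let ?P = "\<lambda>y x. ?q y \<noteq> 0 \<and> 2 * Re (cis x * ?q y) =
    (cmod (u j))\<^sup>2 + (cmod (?S u y))\<^sup>2 - (cmod (v j))\<^sup>2 - (cmod (?S v y))\<^sup>2"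
  have [measurable]: "cis \<in> borel_measurable borel" "cnj \<in> borel_measurable borel"
    by (intro borel_measurable_continuous_onI continuous_intros)+
  have [measurable]: "?S a \<in> borel_measurable (PiM (I - {j}) (\<lambda>_. borel))" for a :: "'i \<Rightarrow> complex"
    by measurable
  \<comment> \<open>This sum is \<open>cnj (?q y)\<close> at the random phases; conjugating makes
    the phases appear as \<open>cis (\<phi> i \<omega>)\<close> rather than as their
    conjugates.\<close>
  have "AE \<omega> in M. (\<Sum>i\<in>I - {j}. cis (\<phi> i \<omega>) * (cnj (v j) * v i - cnj (u j) * u i)) \<noteq> 0"
  proof (rule AE_random_phase_sum_nonzero[OF ind _ _ _ cont])
    show "cnj (v j) * v k - cnj (u j) * u k \<noteq> 0"
    proof
      assume "cnj (v j) * v k - cnj (u j) * u k = 0"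
      then have "cnj (cnj (v j) * v k) = cnj (cnj (u j) * u k)" by simp
      with neq show False by simp
    qed
  qed (use I jk in auto)
  moreover have "AE \<omega> in M. \<not> ?P (restrict (\<lambda>i. \<phi> i \<omega>) (I - {j})) (\<phi> j \<omega>)"
  proof (rule AE_indep_vars_not_countable[OF ind jk(1) order.refl cont])
    show "countable {x. ?P y x}" for y
    proof (cases "?q y = 0")
      case False
      show ?thesis
        by (rule countable_subset[OF _ countable_Re_cis_eq[OF False,
          of "((cmod (u j))\<^sup>2 + (cmod (?S u y))\<^sup>2 - (cmod (v j))\<^sup>2 - (cmod (?S v y))\<^sup>2) / 2"]]) auto
    qed simp
  next
    show "Measurable.pred (PiM (I - {j}) (\<lambda>_. borel) \<Otimes>\<^sub>M borel) (\<lambda>z. ?P (fst z) (snd z))"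
      by (rule measurable_pred_Re_cis_eq) measurable
  qed (use jk in auto)
  ultimately show ?thesis
  proof eventually_elim
    case (elim \<omega>)
    let ?y = "\<lambda>i. \<phi> i \<omega>"
    let ?x = "\<phi> j \<omega>"
    have "cnj (?q ?y) = (\<Sum>i\<in>I - {j}. cis (\<phi> i \<omega>) * (cnj (v j) * v i - cnj (u j) * u i))"
      by (simp add: sum_distrib_left algebra_simps sum_subtractf)
    with elim(1) have "?q ?y \<noteq> 0" by (metis complex_cnj_zero)
    with elim(2) have ne: "2 * Re (cis ?x * ?q ?y) \<noteq>
      (cmod (u j))\<^sup>2 + (cmod (?S u ?y))\<^sup>2 - (cmod (v j))\<^sup>2 - (cmod (?S v ?y))\<^sup>2"
      by simp
    have expand: "(cmod (\<Sum>i\<in>I. cis (\<phi> i \<omega>) * a i))\<^sup>2 =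
      (cmod (a j))\<^sup>2 + (cmod (?S a ?y))\<^sup>2 + 2 * Re (cis ?x * (a j * cnj (?S a ?y)))" for a
    proof -
      have "(\<Sum>i\<in>I. cis (\<phi> i \<omega>) * a i) = cis ?x * a j + ?S a ?y"
        using I jk by (simp add: sum.remove)
      then show ?thesis
        by (simp only: cmod_add_square norm_mult norm_cis mult.assoc mult_1)
    qed
    show ?case
    proof
      assume "cmod (\<Sum>i\<in>I. cis (\<phi> i \<omega>) * v i) = cmod (\<Sum>i\<in>I. cis (\<phi> i \<omega>) * u i)"
      then have "(cmod (\<Sum>i\<in>I. cis (\<phi> i \<omega>) * v i))\<^sup>2 = (cmod (\<Sum>i\<in>I. cis (\<phi> i \<omega>) * u i))\<^sup>2"
        by simp
      then show False
        using ne unfolding expand right_diff_distrib Re_complex_of_real minus_complex.sel by linarith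
    qed
  qed
qed

section \<open>Recovery of a vector from its off-diagonal products\<close>

text \<open>Three nonzero entries recover a diagonal product: \<open>v a * cnj (v a)\<close> times
  \<open>v c * cnj (v b)\<close> rearranges into off-diagonal products. Then \<open>v a\<close> is a
  unimodular multiple of \<open>u a\<close>, and the products with \<open>a\<close> carry this phase
  to all entries. Two entries are too few: \<open>(1, 2)\<close> and \<open>(2, 1)\<close> have the
  same cross products.\<close>

lemma eq_phase_if_cross_products_eq:
  fixes u v :: "'i \<Rightarrow> complex"
  assumes cross: "\<And>j k. j \<in> I \<Longrightarrow> k \<in> I \<Longrightarrow> j \<noteq> k \<Longrightarrow> v j * cnj (v k) = u j * cnj (u k)"
    and abc: "a \<in> I" "b \<in> I" "c \<in> I" "a \<noteq> b" "b \<noteq> c" "a \<noteq> c"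
    and nz: "u a \<noteq> 0" "u b \<noteq> 0" "u c \<noteq> 0"
  obtains \<theta> where "\<And>i. i \<in> I \<Longrightarrow> v i = cis \<theta> * u i"
proof -
  have ab: "v a * cnj (v b) = u a * cnj (u b)" and ca: "v c * cnj (v a) = u c * cnj (u a)"
    and cb: "v c * cnj (v b) = u c * cnj (u b)" using cross abc by auto
  have nzv: "v a \<noteq> 0" "v b \<noteq> 0" "v c \<noteq> 0" using ab ca nz by auto
  have "(v a * cnj (v a)) * (v c * cnj (v b)) = (v a * cnj (v b)) * (v c * cnj (v a))"
    by (simp add: ac_simps)
  also have "\<dots> = (u a * cnj (u a)) * (v c * cnj (v b))"
    unfolding ab ca cb by (simp add: ac_simps)
  finally have aa: "v a * cnj (v a) = u a * cnj (u a)" using nzv by simp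
  then have "cmod (v a) = cmod (u a)"
    by (metis complex_mod_mult_cnj norm_ge_zero power2_eq_iff_nonneg)
  then have "cmod (v a / u a) = 1" using nz by (simp add: norm_divide)
  then obtain \<theta> where \<theta>: "v a / u a = cis \<theta>"
    by (metis complex_norm_eq_1_exp cis_conv_exp)
  then have va: "v a = cis \<theta> * u a" using nz by (simp add: field_simps)
  show thesis
  proof
    fix i assume i: "i \<in> I"
    have "v i * cnj (v a) = u i * cnj (u a)" using aa cross[OF i abc(1)] by (cases "i = a") auto
    then have "v i * cnj (cis \<theta>) * cnj (u a) = u i * cnj (u a)" by (simp add: va ac_simps)
    then have "v i * cnj (cis \<theta>) = u i" using nz by simp
    then have "cis \<theta> * u i = v i * (cis \<theta> * cnj (cis \<theta>))" by (simp add: ac_simps)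
    then show "v i = cis \<theta> * u i" by (simp add: cis_cnj cis_mult)
  qed
qed

section \<open>Complex polynomials with prescribed modulus on the unit circle\<close>

lemma finite_subset_mset: "finite {A. A \<subseteq># B}"
proof (rule finite_subset)
  show "{A. A \<subseteq># B} \<subseteq> (\<Union>n\<le>size B. multisets_of_size (set_mset B) n)"
    by (auto simp: multisets_of_size_def size_mset_mono dest: mset_subset_eqD)
  show "finite (\<Union>n\<le>size B. multisets_of_size (set_mset B) n)"
    by auto
qed

lemma complex_poly_eq_smult_if_proots_eq:
  fixes P Q :: "complex poly"
  assumes "proots P = proots Q" "Q \<noteq> 0"
  obtains c where "P = smult c Q"
proof
  have "smult (lead_coeff P / lead_coeff Q) (smult (lead_coeff Q) (\<Prod>x\<in>#proots Q. [:-x, 1:])) =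
      smult (lead_coeff P) (\<Prod>x\<in>#proots P. [:-x, 1:])"
    using assms by simp
  then show "P = smult (lead_coeff P / lead_coeff Q) Q"
    by (simp only: complex_poly_decompose_multiset)
qed

lemma infinite_unit_circle: "infinite {z::complex. cmod z = 1}"
proof -
  have "inj_on cis {0..1}"
  proof (rule inj_onI)
    fix x y :: real assume "x \<in> {0..1}" "y \<in> {0..1}" "cis x = cis y"
    moreover have "1 \<le> pi" using pi_gt3 by simp
    ultimately show "x = y" by (auto simp: complex_eq_iff intro: cos_inj_pi)
  qed
  then have "infinite (cis ` {0..1})" by (simp add: finite_image_iff)
  then show ?thesis by (rule contrapos_nn) (auto elim!: finite_subset[rotated])
qed

text \<open>The conjugate reciprocal \<open>z ^ N * cnj (P (1 / cnj z))\<close>, for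
  \<open>degree P \<le> N\<close>. The formal degree \<open>N\<close> replaces
  \<open>degree P\<close> so that polynomials of different degrees get the same factor
  \<open>z ^ N\<close>.\<close>

definition conj_reflect :: "nat \<Rightarrow> complex poly \<Rightarrow> complex poly" where
  "conj_reflect N P = (\<Sum>i\<le>N. monom (cnj (coeff P i)) (N - i))"

lemma poly_conj_reflect:
  assumes "degree P \<le> N" and z: "cmod z = 1"
  shows "poly (conj_reflect N P) z = z ^ N * cnj (poly P z)"
proof -
  have z1: "z * cnj z = 1" using z by (simp add: complex_norm_square[symmetric])
  have "z ^ (N - i) = z ^ N * cnj z ^ i" if "i \<le> N" for i
  proof -
    have "z ^ N * cnj z ^ i = z ^ (N - i) * (z * cnj z) ^ i"
      using that by (simp add: power_mult_distrib power_add[symmetric] flip: mult.assoc)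
    then show ?thesis by (simp add: z1)
  qed
  then have "poly (conj_reflect N P) z = (\<Sum>i\<le>N. z ^ N * cnj (coeff P i * z ^ i))"
    by (simp add: conj_reflect_def poly_sum poly_monom mult_ac)
  also have "\<dots> = z ^ N * cnj (poly (\<Sum>i\<le>N. monom (coeff P i) i) z)"
    by (simp add: sum_distrib_left poly_sum poly_monom)
  finally show ?thesis
    using poly_as_sum_of_monoms'[OF assms(1)] by simp
qed

lemma poly_eq_if_eq_on_unit_circle:
  fixes P Q :: "complex poly"
  assumes "\<And>z. cmod z = 1 \<Longrightarrow> poly P z = poly Q z"
  shows "P = Q"
proof (rule ccontr)
  assume "P \<noteq> Q"
  then have "finite {z. poly (P - Q) z = 0}" by (intro poly_roots_finite) simp
  moreover have "{z. cmod z = 1} \<subseteq> {z. poly (P - Q) z = 0}" using assms by auto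
  ultimately show False using infinite_unit_circle finite_subset by blast
qed

text \<open>On the circle each side is \<open>z ^ N\<close> times a squared modulus, so equal moduli
  become a polynomial identity.\<close>

lemma mult_conj_reflect_eq:
  assumes "degree P \<le> N" "degree Q \<le> N"
    and "\<And>z. cmod z = 1 \<Longrightarrow> cmod (poly P z) = cmod (poly Q z)"
  shows "P * conj_reflect N P = Q * conj_reflect N Q"
proof (rule poly_eq_if_eq_on_unit_circle)
  fix z :: complex assume z: "cmod z = 1"
  have "poly (R * conj_reflect N R) z = z ^ N * of_real ((cmod (poly R z))\<^sup>2)" if "degree R \<le> N" for R
    unfolding poly_mult poly_conj_reflect[OF that z] complex_norm_square by (simp add: ac_simps)
  then show "poly (P * conj_reflect N P) z = poly (Q * conj_reflect N Q) z"
    using assms z by simp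
qed

text \<open>
  \<open>|Q| = |P|\<close> on the circle means \<open>Q Q\<^sup># = P P\<^sup>#\<close> for the conjugate reflection, so the roots of
  \<open>Q\<close> form a sub-multiset of those of \<open>P P\<^sup>#\<close>.
\<close>
lemma finite_proots_equal_modulus:
  fixes P :: "complex poly"
  assumes "P \<noteq> 0" "degree P \<le> N"
  shows "finite (proots ` {Q. degree Q \<le> N \<and> (\<forall>z. cmod z = 1 \<longrightarrow> cmod (poly Q z) = cmod (poly P z))})"
proof (rule finite_subset[OF _ finite_subset_mset])
  let ?R = "P * conj_reflect N P"
  \<comment> \<open>Nonvanishing is what lets \<open>proots\<close> split over the product
    \<open>Q * conj_reflect N Q\<close> below. A zero reflection would force \<open>P\<close> to
    vanish on the whole circle.\<close>
  have nz: "?R \<noteq> 0"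
  proof
    assume "?R = 0"
    then have "conj_reflect N P = 0" using assms by simp
    have "poly P z = poly 0 z" if "cmod z = 1" for z
      using poly_conj_reflect[OF assms(2) that] \<open>conj_reflect N P = 0\<close> that by auto
    then have "P = 0" by (rule poly_eq_if_eq_on_unit_circle)
    with assms show False by simp
  qed
  show "proots ` {Q. degree Q \<le> N \<and> (\<forall>z. cmod z = 1 \<longrightarrow> cmod (poly Q z) = cmod (poly P z))}
      \<subseteq> {A. A \<subseteq># proots ?R}"
  proof clarify
    fix Q assume "degree Q \<le> N" "\<forall>z. cmod z = 1 \<longrightarrow> cmod (poly Q z) = cmod (poly P z)"
    then have eq: "?R = Q * conj_reflect N Q"
      using assms by (intro mult_conj_reflect_eq) auto
    with nz have "proots ?R = proots Q + proots (conj_reflect N Q)"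
      by (metis proots_mult mult_eq_0_iff)
    then show "proots Q \<subseteq># proots ?R" by simp
  qed
qed

text \<open>Equal root multisets leave only a scalar factor; a point of the circle where
  \<open>R\<close> is nonzero forces that scalar to have modulus one.\<close>

lemma equal_modulus_proots_eq_imp_phase:
  fixes P Q R :: "complex poly"
  assumes "R \<noteq> 0" "proots P = proots Q"
    and "\<And>z. cmod z = 1 \<Longrightarrow> cmod (poly P z) = cmod (poly R z)"
    and "\<And>z. cmod z = 1 \<Longrightarrow> cmod (poly Q z) = cmod (poly R z)"
  obtains \<theta> where "P = smult (cis \<theta>) Q"
proof -
  obtain z where z: "cmod z = 1" "poly R z \<noteq> 0"
    using poly_eq_if_eq_on_unit_circle[of R 0] assms(1) by auto
  have "Q \<noteq> 0" using z assms(4)[OF z(1)] by auto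
  then obtain c where c: "P = smult c Q"
    using complex_poly_eq_smult_if_proots_eq assms(2) by blast
  have "cmod c * cmod (poly R z) = cmod (poly R z)"
    using assms(3,4)[OF z(1)] by (simp add: c norm_mult)
  then have "cmod c = 1" using z by simp
  then obtain \<theta> where "c = cis \<theta>" by (metis complex_norm_eq_1_exp cis_conv_exp)
  with c that show thesis by blast
qed

section \<open>Kronecker substitution and the finite set of candidates\<close>

text \<open>Both coordinates are shifted to start at 0 and read as base-\<open>p\<close> digits,
  \<open>k1\<close> being the low one, so distinct pixels receive distinct exponents.\<close>

definition zindex :: "nat \<Rightarrow> int \<times> int \<Rightarrow> nat" where
  "zindex p = (\<lambda>(k1, k2). nat (k1 + (int p - 1) div 2 + int p * (k2 + (int p - 1) div 2)))"

definition zpoly :: "nat \<Rightarrow> (int \<times> int \<Rightarrow> complex) \<Rightarrow> complex poly" where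
  "zpoly p v = (\<Sum>k\<in>Zc p \<times> Zc p. monom (v k) (zindex p k))"

lemma Zc_shift_bounds:
  assumes "k \<in> Zc p"
  shows "0 \<le> k + (int p - 1) div 2" "k + (int p - 1) div 2 < int p"
  using assms by (auto simp: Zc_def)

lemma of_nat_zindex:
  assumes "(k1, k2) \<in> Zc p \<times> Zc p"
  shows "int (zindex p (k1, k2)) = k1 + (int p - 1) div 2 + int p * (k2 + (int p - 1) div 2)"
  using assms Zc_shift_bounds(1)[of k1 p] Zc_shift_bounds(1)[of k2 p] by (auto simp: zindex_def)

lemma inj_on_zindex: "inj_on (zindex p) (Zc p \<times> Zc p)"
proof (rule inj_onI, clarify)
  fix a b c d
  assume 1: "a \<in> Zc p" "b \<in> Zc p" "c \<in> Zc p" "d \<in> Zc p"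
    and "zindex p (a, b) = zindex p (c, d)"
  define h where "h = (int p - 1) div 2"
  have eq: "a + h + int p * (b + h) = c + h + int p * (d + h)"
    using of_nat_zindex[of a b p] of_nat_zindex[of c d p] 1 \<open>zindex p (a, b) = _\<close>
    by (simp add: h_def)
  have bd: "0 \<le> a + h" "a + h < int p" "0 \<le> c + h" "c + h < int p"
    using 1[THEN Zc_shift_bounds(1)] 1[THEN Zc_shift_bounds(2)] by (auto simp: h_def)
  have "(a + h + int p * (b + h)) mod int p = a + h" "(c + h + int p * (d + h)) mod int p = c + h"
    using bd by auto
  with eq have "a + h = c + h" by metis
  then have "a = c" by simp
  with eq bd show "a = c \<and> b = d" by auto
qed

lemma coeff_zpoly:
  assumes "k \<in> Zc p \<times> Zc p"
  shows "coeff (zpoly p v) (zindex p k) = v k"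
proof -
  have "coeff (zpoly p v) (zindex p k) = (\<Sum>j\<in>Zc p \<times> Zc p. if j = k then v j else 0)"
    unfolding zpoly_def coeff_sum
    by (intro sum.cong refl) (use assms inj_on_zindex[of p] in \<open>auto simp: inj_on_eq_iff\<close>)
  then show ?thesis using assms by (simp add: Zc_def)
qed

text \<open>The bound serves as the common formal degree \<open>N\<close> of the reflections, so it
  need not be sharp.\<close>

lemma degree_zpoly_le: "degree (zpoly p v) \<le> p * p"
  unfolding zpoly_def
proof (rule degree_sum_le)
  fix k assume k: "k \<in> Zc p \<times> Zc p"
  then obtain a b where ab: "k = (a, b)" "a \<in> Zc p" "b \<in> Zc p" by auto
  define h where "h = (int p - 1) div 2"
  have "b + h \<le> int p - 1" "a + h \<le> int p"
    using Zc_shift_bounds(2)[of a p] Zc_shift_bounds(2)[of b p] ab by (auto simp: h_def)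
  then have "a + h + int p * (b + h) \<le> int p + int p * (int p - 1)"
    by (intro add_mono mult_left_mono) auto
  then have "int (zindex p k) \<le> int p * int p"
    using of_nat_zindex[of a b p] ab by (simp add: h_def algebra_simps)
  then have "zindex p k \<le> p * p" by (metis of_nat_le_iff of_nat_mult)
  then show "degree (monom (v k) (zindex p k)) \<le> p * p"
    using degree_monom_le order.trans by blast
qed (simp add: Zc_def)

text \<open>
  Kronecker substitution: the line of slope \<open>p\<close> in the frequency plane, reduced modulo the
  periods of the Fourier transform, turns it into a univariate polynomial on the unit circle.
\<close>
lemma cmod_zpoly_eq_fourier:
  assumes "cmod z = 1"
  obtains w where "w \<in> freq_domain" "\<And>v. cmod (poly (zpoly p v) z) = cmod (fourier p v w)"
proof -
  obtain t where t: "z = cis t" using assms by (metis complex_norm_eq_1_exp cis_conv_exp)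
  \<comment> \<open>The sign matches the minus sign in the exponent of \<open>fourier\<close>.
    Subtracting nearest integers from \<open>s\<close> and \<open>p * s\<close> moves the frequency
    into \<open>freq_domain\<close>.\<close>
  define s where "s = - t / (2 * pi)"
  define w where "w = (s - of_int (round s), real p * s - of_int (round (real p * s)))"
  define h where "h = (int p - 1) div 2"
  \<comment> \<open>The factor caused by the index shift \<open>h\<close> in both coordinates; it is
    unimodular and independent of \<open>v\<close>.\<close>
  define c where "c = cis (t * (of_int h + real p * of_int h))"
  have "w \<in> freq_domain"
    using of_int_round_abs_le[of s] of_int_round_abs_le[of "real p * s"]
    unfolding w_def freq_domain_def mem_Times_iff fst_conv snd_conv atLeastAtMost_iff
    by linarith
  moreover have "cmod (poly (zpoly p v) z) = cmod (fourier p v w)" for v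
  proof -
    have power: "z ^ zindex p k =
        c * exp (- \<i> * complex_of_real (2 * pi * (of_int (fst k) * fst w + of_int (snd k) * snd w)))"
      if k: "k \<in> Zc p \<times> Zc p" for k
    proof -
      obtain a b where ab: "k = (a, b)" by force
      \<comment> \<open>The number of full turns removed by the rounding.\<close>
      let ?m = "a * round s + b * round (real p * s)"
      have "real (zindex p k) = of_int (int (zindex p k))" by simp
      also have "int (zindex p k) = a + h + int p * (b + h)"
        using of_nat_zindex[of a b p] k ab by (simp add: h_def)
      finally have idx: "real (zindex p k) = of_int a + of_int h + real p * (of_int b + of_int h)"
        by simp
      have "exp (- \<i> * complex_of_real (2 * pi * (of_int a * fst w + of_int b * snd w))) =
          cis (- (2 * pi * (of_int a * fst w + of_int b * snd w)))"
        by (simp add: cis_conv_exp)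
      also have "- (2 * pi * (of_int a * fst w + of_int b * snd w)) =
          t * (of_int a + real p * of_int b) + 2 * pi * of_int ?m"
        by (simp add: w_def s_def field_simps)
      also have "cis \<dots> = cis (t * (of_int a + real p * of_int b))"
        by (simp only: cis_mult[symmetric] cis_multiple_2pi[OF Ints_of_int] mult_1_right)
      finally have "c * exp (- \<i> * complex_of_real (2 * pi * (of_int a * fst w + of_int b * snd w))) =
          cis (real (zindex p k) * t)"
        by (simp add: c_def cis_mult idx algebra_simps)
      then show ?thesis by (simp only: t Complex.DeMoivre ab fst_conv snd_conv)
    qed
    have "poly (zpoly p v) z = c * fourier p v w"
      unfolding zpoly_def fourier_def poly_sum poly_monom sum_distrib_left
      by (intro sum.cong refl) (simp add: power ac_simps split: prod.split)
    then show ?thesis by (simp add: norm_mult c_def)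
  qed
  ultimately show thesis using that by blast
qed

text \<open>The nonzero pixel makes \<open>zpoly p u\<close> nonzero, so only finitely many root
  multisets occur among the polynomials of admissible \<open>v\<close>, and each multiset fixes
  \<open>v\<close> up to a phase. Since \<open>V\<close> depends on \<open>u\<close> alone and not
  on the mask, almost sure statements about its members can be combined.\<close>

lemma finite_fourier_modulus_class:
  fixes u :: "int \<times> int \<Rightarrow> complex"
  assumes k: "k \<in> Zc p \<times> Zc p" "u k \<noteq> 0"
  obtains V where "finite V"
    "\<And>v. supp v \<subseteq> Zc p \<times> Zc p \<Longrightarrow>
      (\<And>w. w \<in> freq_domain \<Longrightarrow> cmod (fourier p v w) = cmod (fourier p u w)) \<Longrightarrow>
      \<exists>r\<in>V. \<exists>\<theta>. v = (\<lambda>k. cis \<theta> * r k)"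
proof -
  define S where "S = {v. supp v \<subseteq> Zc p \<times> Zc p \<and>
    (\<forall>w\<in>freq_domain. cmod (fourier p v w) = cmod (fourier p u w))}"
  have mod: "cmod (poly (zpoly p v) z) = cmod (poly (zpoly p u) z)" if "v \<in> S" "cmod z = 1" for v z
    by (rule cmod_zpoly_eq_fourier[OF that(2), of p]) (use that(1) in \<open>simp add: S_def\<close>)
  have nz: "zpoly p u \<noteq> 0" using coeff_zpoly[OF k(1), of u] k(2) by auto
  define key where "key v = proots (zpoly p v)" for v
  \<comment> \<open>One representative for each root multiset that occurs.\<close>
  define V where "V = (\<lambda>A. SOME v. v \<in> S \<and> key v = A) ` key ` S"
  show thesis
  proof
    have "key ` S \<subseteq> proots ` {Q. degree Q \<le> p * p \<and>
        (\<forall>z. cmod z = 1 \<longrightarrow> cmod (poly Q z) = cmod (poly (zpoly p u) z))}"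
      using mod degree_zpoly_le by (auto simp: key_def)
    then have "finite (key ` S)"
      using finite_proots_equal_modulus[OF nz degree_zpoly_le] finite_subset by blast
    then show "finite V" by (simp add: V_def)
  next
    fix v assume "supp v \<subseteq> Zc p \<times> Zc p"
      and "\<And>w. w \<in> freq_domain \<Longrightarrow> cmod (fourier p v w) = cmod (fourier p u w)"
    then have v: "v \<in> S" by (simp add: S_def)
    define r where "r = (SOME r. r \<in> S \<and> key r = key v)"
    have r: "r \<in> S" "key r = key v"
      using someI[of "\<lambda>r. r \<in> S \<and> key r = key v" v] v by (auto simp: r_def)
    obtain \<theta> where \<theta>: "zpoly p v = smult (cis \<theta>) (zpoly p r)"
      using equal_modulus_proots_eq_imp_phase[OF nz, of "zpoly p v" "zpoly p r"] mod v r
      unfolding key_def by metis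
    have "v k = cis \<theta> * r k" for k
    proof (cases "k \<in> Zc p \<times> Zc p")
      case True
      then show ?thesis using coeff_zpoly[OF True] \<theta> by (metis coeff_smult)
    next
      case False
      then have "v k = 0" "r k = 0" using v r by (auto simp: S_def supp_def)
      then show ?thesis by simp
    qed
    moreover have "r \<in> V" using v by (auto simp: V_def r_def)
    ultimately show "\<exists>r\<in>V. \<exists>\<theta>. v = (\<lambda>k. cis \<theta> * r k)" by blast
  qed
qed

section \<open>Three support points and the final argument\<close>

text \<open>At most two points always lie on a common line.\<close>

lemma obtain_three_points_if_not_collinear:
  assumes "finite S" "\<not> subset_of_line S"
  obtains a b c where "a \<in> S" "b \<in> S" "c \<in> S" "a \<noteq> b" "b \<noteq> c" "a \<noteq> c"
proof -
  let ?f = "\<lambda>(a, b). (real_of_int a, real_of_int b)"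
  have "\<not> card S \<le> 2"
  proof
    assume "card S \<le> 2"
    then have "card (?f ` S) \<le> 2" using card_image_le[OF assms(1), of ?f] by simp
    then have "collinear (?f ` S)" using assms(1) by (intro collinear_small) auto
    with assms(2) show False by (simp add: subset_of_line_def)
  qed
  then have "card S \<ge> 3" by simp
  then obtain T where "T \<subseteq> S" "card T = 3" by (rule obtain_subset_with_card_n) auto
  then show thesis using that by (auto simp: card_3_iff)
qed

theorem theorem3p4:
  fixes n p :: nat
    and f :: "int \<times> int \<times> int \<Rightarrow> complex"
    and t :: "real \<times> real \<times> real"
    and l :: "int \<times> int"
    and M :: "'a measure"
    and \<mu> :: "int \<times> int \<Rightarrow> 'a \<Rightarrow> complex"
  assumes "odd n" and "p = 2 * n - 1"
    and "f \<in> objects n"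
    and "direction t"
    and "supp (translate l (projection n f t)) \<subseteq> Zc n \<times> Zc n"
    and "\<not> subset_of_line (supp (projection n f t))"
    and "prob_space M"
    and "mask_assumption M p \<mu>"
  shows "AE \<omega> in M. \<forall>g\<in>objects n.
           supp (translate l (projection n g t)) \<subseteq> Zc n \<times> Zc n \<longrightarrow>
           (\<forall>w\<in>freq_domain.
              (cmod (fourier p (translate l (projection n g t)) w))\<^sup>2
              = (cmod (fourier p (translate l (projection n f t)) w))\<^sup>2) \<longrightarrow>
           (\<forall>w\<in>freq_domain.
              (cmod (fourier p (\<lambda>k. \<mu> k \<omega> * translate l (projection n g t) k) w))\<^sup>2
              = (cmod (fourier p (\<lambda>k. \<mu> k \<omega> * translate l (projection n f t) k) w))\<^sup>2) \<longrightarrow>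
           (\<exists>\<theta>::real. projection n g t
                       = (\<lambda>c. exp (\<i> * complex_of_real \<theta>) * projection n f t c))"
proof -
  interpret prob_space M by fact
  let ?I = "Zc p \<times> Zc p"
  have fin: "finite ?I" by (simp add: Zc_def)
  have "n > 0" using \<open>odd n\<close> by (rule odd_pos)
  \<comment> \<open>For positive \<open>n\<close> the natural subtraction is exact and
    \<open>2 * n - 1 \<ge> n\<close>.\<close>
  then have sub: "Zc n \<times> Zc n \<subseteq> ?I"
    unfolding Zc_def \<open>p = _\<close> by (intro Sigma_mono) auto
  define u where "u = translate l (projection n f t)"
  have supp_u: "supp u \<subseteq> ?I" using assms(5) sub by (auto simp: u_def)
  obtain \<phi> where ind: "indep_vars (\<lambda>_. borel) \<phi> ?I"
    and cont: "\<And>k. k \<in> ?I \<Longrightarrow> continuous_on UNIV (cdf (distr M borel (\<phi> k)))"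
    and \<mu>: "\<And>k \<omega>. k \<in> ?I \<Longrightarrow> \<omega> \<in> space M \<Longrightarrow> \<mu> k \<omega> = cis (\<phi> k \<omega>)"
    using assms(8) unfolding mask_assumption_def cis_conv_exp by blast
  have "supp (projection n f t) \<subseteq> ?I"
  proof
    fix c assume "c \<in> supp (projection n f t)"
    then show "c \<in> ?I"
      by (cases t; cases c) (auto simp: supp_def projection_def Let_def \<open>p = _\<close> split: if_splits)
  qed
  then have "finite (supp (projection n f t))" using fin finite_subset by blast
  \<comment> \<open>The points are found in the untranslated support and moved by \<open>- l\<close>
    into \<open>supp u\<close>.\<close>
  then obtain a b c where abc: "a \<in> supp u" "b \<in> supp u" "c \<in> supp u" "a \<noteq> b" "b \<noteq> c" "a \<noteq> c"
  proof (rule obtain_three_points_if_not_collinear[OF _ assms(6)])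
    fix a' b' c'
    assume "a' \<in> supp (projection n f t)" "b' \<in> supp (projection n f t)" "c' \<in> supp (projection n f t)"
      "a' \<noteq> b'" "b' \<noteq> c'" "a' \<noteq> c'"
    then show thesis
      by (intro that[of "a' - l" "b' - l" "c' - l"])
        (auto simp: supp_def u_def translate_def simp flip: fst_add snd_add)
  qed
  then have nz: "u a \<noteq> 0" "u b \<noteq> 0" "u c \<noteq> 0" and abcI: "a \<in> ?I" "b \<in> ?I" "c \<in> ?I"
    using supp_u by (auto simp: supp_def)
  \<comment> \<open>The modulus of the masked transform at frequency \<open>(0, 0)\<close>, where
    the Fourier kernel is 1.\<close>
  define F where "F \<omega> v = cmod (\<Sum>i\<in>?I. cis (\<phi> i \<omega>) * v i)" for \<omega> v
  obtain V where V: "finite V"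
    "\<And>v. supp v \<subseteq> ?I \<Longrightarrow> (\<And>w. w \<in> freq_domain \<Longrightarrow> cmod (fourier p v w) = cmod (fourier p u w)) \<Longrightarrow>
      \<exists>r\<in>V. \<exists>\<theta>. v = (\<lambda>k. cis \<theta> * r k)"
    using finite_fourier_modulus_class[of a p u, OF abcI(1) nz(1)] by blast
  \<comment> \<open>Here \<open>r\<close> is fixed before \<open>\<omega>\<close>. Either all cross
    products agree and the phase exists outright, or the premise fails almost surely.\<close>
  have "AE \<omega> in M. F \<omega> r = F \<omega> u \<longrightarrow> (\<exists>\<theta>. \<forall>k\<in>?I. r k = cis \<theta> * u k)" for r
  proof (cases "\<forall>j\<in>?I. \<forall>k\<in>?I. j \<noteq> k \<longrightarrow> r j * cnj (r k) = u j * cnj (u k)")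
    case True
    then obtain \<theta> where "\<And>k. k \<in> ?I \<Longrightarrow> r k = cis \<theta> * u k"
      using eq_phase_if_cross_products_eq[of ?I r u a b c] abcI abc(4-6) nz by blast
    then show ?thesis by auto
  next
    case False
    then obtain j k where jk: "j \<in> ?I" "k \<in> ?I" "j \<noteq> k" "r j * cnj (r k) \<noteq> u j * cnj (u k)"
      by blast
    have "AE \<omega> in M. F \<omega> r \<noteq> F \<omega> u"
      unfolding F_def by (rule AE_cmod_random_phase_sum_neq[OF ind fin jk(1-3) _ jk(4)]) (rule cont)
    then show ?thesis by eventually_elim simp
  qed
  \<comment> \<open>Finiteness of \<open>V\<close> unites the null sets into one, so that
    \<open>g\<close> may be chosen after \<open>\<omega>\<close>.\<close>
  then have "AE \<omega> in M. \<forall>r\<in>V. F \<omega> r = F \<omega> u \<longrightarrow> (\<exists>\<theta>. \<forall>k\<in>?I. r k = cis \<theta> * u k)"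
    using V(1) by (intro AE_finite_allI) auto
  moreover have "AE \<omega> in M. \<omega> \<in> space M" by simp
  ultimately show ?thesis
  proof (eventually_elim, intro ballI impI, fold u_def)
    fix \<omega> g
    assume det: "\<forall>r\<in>V. F \<omega> r = F \<omega> u \<longrightarrow> (\<exists>\<theta>. \<forall>k\<in>?I. r k = cis \<theta> * u k)" and \<omega>: "\<omega> \<in> space M"
      and supp_g: "supp (translate l (projection n g t)) \<subseteq> Zc n \<times> Zc n"
      and plain: "\<forall>w\<in>freq_domain. (cmod (fourier p (translate l (projection n g t)) w))\<^sup>2 =
        (cmod (fourier p u w))\<^sup>2"
      and masked: "\<forall>w\<in>freq_domain. (cmod (fourier p (\<lambda>k. \<mu> k \<omega> * translate l (projection n g t) k) w))\<^sup>2 =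
        (cmod (fourier p (\<lambda>k. \<mu> k \<omega> * u k) w))\<^sup>2"
    define v where "v = translate l (projection n g t)"
    have supp_v: "supp v \<subseteq> ?I" using supp_g sub by (auto simp: v_def)
    have "cmod (fourier p v w) = cmod (fourier p u w)" if "w \<in> freq_domain" for w
      using plain that by (auto simp: v_def)
    from V(2)[OF supp_v this] obtain r \<theta> where r: "r \<in> V" "v = (\<lambda>k. cis \<theta> * r k)" by blast
    have F: "cmod (fourier p (\<lambda>k. \<mu> k \<omega> * x k) (0, 0)) = F \<omega> x" for x
      unfolding fourier_def F_def
      by (intro arg_cong[of _ _ cmod] sum.cong refl) (use \<mu> \<omega> in auto)
    have "(0, 0) \<in> freq_domain" by (simp add: freq_domain_def)
    with masked have "F \<omega> v = F \<omega> u" by (auto simp: v_def simp flip: F)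
    \<comment> \<open>A global phase leaves \<open>F\<close> unchanged, so the masked equality
      passes from \<open>v\<close> to its representative \<open>r\<close>.\<close>
    moreover have "(\<Sum>i\<in>?I. cis (\<phi> i \<omega>) * v i) = cis \<theta> * (\<Sum>i\<in>?I. cis (\<phi> i \<omega>) * r i)"
      unfolding r(2) sum_distrib_left by (intro sum.cong refl) (simp add: ac_simps)
    then have "F \<omega> v = F \<omega> r" by (simp add: F_def norm_mult)
    ultimately obtain \<theta>' where \<theta>': "\<And>k. k \<in> ?I \<Longrightarrow> r k = cis \<theta>' * u k"
      using det r(1) by metis
    \<comment> \<open>All integer points are needed, because undoing the translation evaluates at
      \<open>c - l\<close>, which may lie outside \<open>?I\<close>.\<close>
    have v_eq: "v k = cis (\<theta> + \<theta>') * u k" for k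
    proof (cases "k \<in> ?I")
      case True
      then show ?thesis by (simp add: r(2) \<theta>' cis_mult[symmetric] mult.assoc)
    next
      case False
      then have "v k = 0" "u k = 0" using supp_u supp_v by (auto simp: supp_def)
      then show ?thesis by simp
    qed
    have "projection n g t c = exp (\<i> * complex_of_real (\<theta> + \<theta>')) * projection n f t c" for c
      using v_eq[of "(fst c - fst l, snd c - snd l)"]
      by (simp add: u_def v_def translate_def cis_conv_exp)
    then show "\<exists>\<theta>::real. projection n g t = (\<lambda>c. exp (\<i> * complex_of_real \<theta>) * projection n f t c)"
      by blast
  qed
qed

end
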